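(* Let $H,K$ be real or complex Hilbert spaces and let $A,B$ be densely defined (not necessarily closed or closable) linear operators from $H$ to $K$. The following statements are equivalent: (i) $\operatorname{dom}(A+B)$ is dense in $H$ and $(A+B)^*=A^*+B^*$; (ii) $G(A+B)^{\perp}\subseteq \operatorname{ran} M_{A+B,\,A^*+B^*}$.
   Context: Operators are (possibly unbounded) linear maps defined on a linear subspace; $\operatorname{dom}(A+B)=\operatorname{dom}A\cap\operatorname{dom}B$ and $\operatorname{dom}(A^*+B^* )=\operatorname{dom}A^*\cap\operatorname{dom}B^*$. For an operator $S$ from $H$ to $K$, $G(S)=\{(x,Sx): x\in\operatorname{dom}S\}\subseteq H\times K$ is its graph, and $\perp$ denotes orthogonal complement in the product Hilbert space $H\times K$. For operators $S$ from $H$ to $K$ and $T$ from $K$ to $H$, $M_{S,T}$ is the operator in $H\times K$ with domain $\operatorname{dom}S\times\operatorname{dom}T$ given by $M_{S,T}(x,y)=(x-Ty,\;Sx+y)$. *)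

theory Defs
  imports "HOL-Analysis.Analysis"
begin

text \<open>
  Scalar fields: the reals (with trivial conjugation) or the complex numbers (with complex
  conjugation). By the Gelfand--Mazur theorem for real normed fields, these are, up to
  isomorphism, the only models of the following class.
\<close>

class real_or_complex = real_normed_field +
  fixes conjugate :: "'a \<Rightarrow> 'a"
  assumes conjugate_add: "conjugate (a + b) = conjugate a + conjugate b"
    and conjugate_mult: "conjugate (a * b) = conjugate a * conjugate b"
    and conjugate_conjugate: "conjugate (conjugate a) = a"
    and mult_conjugate: "a * conjugate a = (norm a)\<^sup>2 *\<^sub>R 1"

instantiation real :: real_or_complex
begin

definition conjugate_real :: "real \<Rightarrow> real"
  where "conjugate_real a = a"

instance
  by standard (simp_all add: conjugate_real_def power2_eq_square)

end

instantiation complex :: real_or_complex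
begin

definition conjugate_complex :: "complex \<Rightarrow> complex"
  where "conjugate_complex a = cnj a"

instance
  by standard (simp_all add: conjugate_complex_def complex_norm_square scaleR_conv_of_real
      flip: of_real_power)

end

text \<open>
  The underlying real structure, the norm and the completeness come from the library classes;
  \<open>scale\<close> and \<open>ip\<close> extend the real scalar multiplication and the real inner product to the
  scalar field. The inner product is linear in its first argument.
\<close>

locale hilbert_space = vector_space scale
  for scale :: "'s::real_or_complex \<Rightarrow> 'h::{real_inner,complete_space} \<Rightarrow> 'h" +
  fixes ip :: "'h \<Rightarrow> 'h \<Rightarrow> 's"
  assumes scale_of_real: "scale (of_real r) x = r *\<^sub>R x"
    and ip_add_left: "ip (x + y) z = ip x z + ip y z"
    and ip_scale_left: "ip (scale c x) y = c * ip x y"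
    and ip_commute: "ip y x = conjugate (ip x y)"
    and ip_self: "ip x x = of_real (inner x x)"

lemma hilbert_space_real:
  "hilbert_space (scaleR :: real \<Rightarrow> 'h::{real_inner,complete_space} \<Rightarrow> 'h) inner"
  by unfold_locales
    (simp_all add: algebra_simps inner_add_left inner_commute conjugate_real_def)

lemma hilbert_space_complex:
  "hilbert_space ((*) :: complex \<Rightarrow> complex \<Rightarrow> complex) (\<lambda>x y. x * cnj y)"
  by unfold_locales
    (simp_all add: algebra_simps scaleR_conv_of_real conjugate_complex_def complex_norm_square
      flip: power2_norm_eq_inner of_real_power)

definition prod_scale :: "('s \<Rightarrow> 'h \<Rightarrow> 'h) \<Rightarrow> ('s \<Rightarrow> 'k \<Rightarrow> 'k) \<Rightarrow> 's \<Rightarrow> 'h \<times> 'k \<Rightarrow> 'h \<times> 'k"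
  where "prod_scale scaleH scaleK c = (\<lambda>(x, y). (scaleH c x, scaleK c y))"

definition prod_ip ::
  "('h \<Rightarrow> 'h \<Rightarrow> 's::plus) \<Rightarrow> ('k \<Rightarrow> 'k \<Rightarrow> 's) \<Rightarrow> 'h \<times> 'k \<Rightarrow> 'h \<times> 'k \<Rightarrow> 's"
  where "prod_ip ipH ipK = (\<lambda>(x, y) (x', y'). ipH x x' + ipK y y')"

lemma hilbert_space_prod:
  assumes "hilbert_space scaleH ipH" and "hilbert_space scaleK ipK"
  shows "hilbert_space (prod_scale scaleH scaleK) (prod_ip ipH ipK)"
proof -
  interpret H: hilbert_space scaleH ipH by fact
  interpret K: hilbert_space scaleK ipK by fact
  show ?thesis
    by unfold_locales
      (auto simp: prod_scale_def prod_ip_def algebra_simps conjugate_add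
        H.scale_right_distrib K.scale_right_distrib H.scale_left_distrib K.scale_left_distrib
        H.scale_of_real K.scale_of_real H.ip_add_left K.ip_add_left H.ip_scale_left
        K.ip_scale_left H.ip_self K.ip_self
        H.ip_commute[symmetric] K.ip_commute[symmetric])
qed

definition ortho_compl :: "('v \<Rightarrow> 'v \<Rightarrow> 's::zero) \<Rightarrow> 'v set \<Rightarrow> 'v set"
  where "ortho_compl ip W = {v. \<forall>w\<in>W. ip w v = 0}"

text \<open>
  Operators are partial functions, so that equality of operators includes equality of their
  domains, and the library's \<^const>\<open>dom\<close>, \<^const>\<open>ran\<close> and \<^const>\<open>Map.graph\<close> are the
  domain, range and graph of an operator.
\<close>

definition linear_operator ::
  "('s::field \<Rightarrow> 'h::ab_group_add \<Rightarrow> 'h) \<Rightarrow> ('s \<Rightarrow> 'k::ab_group_add \<Rightarrow> 'k) \<Rightarrow> ('h \<rightharpoonup> 'k) \<Rightarrow> bool"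
  where "linear_operator scaleH scaleK S \<longleftrightarrow>
    module.subspace scaleH (dom S) \<and>
    (\<forall>x\<in>dom S. \<forall>y\<in>dom S. the (S (x + y)) = the (S x) + the (S y)) \<and>
    (\<forall>c. \<forall>x\<in>dom S. the (S (scaleH c x)) = scaleK c (the (S x)))"

definition densely_defined :: "('h::topological_space \<rightharpoonup> 'k) \<Rightarrow> bool"
  where "densely_defined S \<longleftrightarrow> closure (dom S) = UNIV"

definition op_add :: "('h \<rightharpoonup> 'k::plus) \<Rightarrow> ('h \<rightharpoonup> 'k) \<Rightarrow> ('h \<rightharpoonup> 'k)"
  where "op_add A B = (\<lambda>x. if x \<in> dom A \<inter> dom B then Some (the (A x) + the (B x)) else None)"

text \<open>
  The vector \<open>z\<close> below is unique, and hence the adjoint meaningful, when \<open>S\<close> is densely defined.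
\<close>

definition adjoint_op ::
  "('h \<Rightarrow> 'h \<Rightarrow> 's) \<Rightarrow> ('k \<Rightarrow> 'k \<Rightarrow> 's) \<Rightarrow> ('h \<rightharpoonup> 'k) \<Rightarrow> ('k \<rightharpoonup> 'h)"
  where "adjoint_op ipH ipK S = (\<lambda>y.
    if \<exists>z. \<forall>x\<in>dom S. ipK (the (S x)) y = ipH x z
    then Some (THE z. \<forall>x\<in>dom S. ipK (the (S x)) y = ipH x z)
    else None)"

definition block_op :: "('h::minus \<rightharpoonup> 'k::plus) \<Rightarrow> ('k \<rightharpoonup> 'h) \<Rightarrow> ('h \<times> 'k \<rightharpoonup> 'h \<times> 'k)"
  where "block_op S T = (\<lambda>(x, y).
    if x \<in> dom S \<and> y \<in> dom T then Some (x - the (T y), the (S x) + y) else None)"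

end

theory Submission
  imports Defs
begin

text \<open>
  Put \<open>S = A + B\<close> and \<open>T = A\<^sup>* + B\<^sup>*\<close>, so that \<open>\<langle>Sx, y\<rangle> = \<langle>x, Ty\<rangle>\<close> on the domains. If \<open>S\<close> is
  densely defined and \<open>S\<^sup>* = T\<close>, a vector orthogonal to the graph of \<open>S\<close> has the form
  \<open>(- Ty, y)\<close>, the image of \<open>(0, y)\<close> under the block operator. Conversely, if
  \<open>(x - Ty, Sx + y)\<close> is orthogonal to the graph, pairing it with \<open>(x, Sx)\<close> gives
  \<open>\<parallel>x\<parallel>\<^sup>2 + \<parallel>Sx\<parallel>\<^sup>2 = 0\<close>, so it is \<open>(- Ty, y)\<close>. Under (ii) this
  applies to \<open>(u, 0)\<close> with \<open>u\<close> orthogonal to \<open>dom S\<close>, which yields density, and to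
  \<open>(- S\<^sup>*y, y)\<close>, which yields \<open>S\<^sup>* \<subseteq> T\<close>.
\<close>

section \<open>Orthogonal projection in real Hilbert spaces\<close>

text \<open>A point \<open>l\<close> of \<open>M\<close> nearest to \<open>x\<close> exists by
  completeness, and the residual \<open>x - l\<close> is the required vector: it is nonzero because
  \<open>x\<close> lies outside \<open>M\<close>, and orthogonal to \<open>M\<close> because moving
  \<open>l\<close> within \<open>M\<close> cannot shorten it.\<close>

lemma exists_orthogonal_to_proper_closed_subspace:
  fixes M :: "'a::{real_inner,complete_space} set"
  assumes "subspace M" "closed M" "x \<notin> M"
  obtains u where "u \<noteq> 0" "\<And>m. m \<in> M \<Longrightarrow> inner u m = 0"
proof -
  define d where "d = (INF m\<in>M. (norm (x - m))\<^sup>2)"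
  \<comment> \<open>The near-minimizers form nested, nonempty, closed sets whose diameters shrink to
    0, so completeness yields a common point, which is the nearest point.\<close>
  define C where "C n = {m\<in>M. (norm (x - m))\<^sup>2 \<le> d + 1 / real (Suc n)}" for n
  have bdd: "bdd_below ((\<lambda>m. (norm (x - m))\<^sup>2) ` M)"
    by (rule bdd_belowI[of _ 0]) auto
  have d_le: "d \<le> (norm (x - m))\<^sup>2" if "m \<in> M" for m
    unfolding d_def by (rule cINF_lower[OF bdd that])
  have "M \<noteq> {}"
    using subspace_0[OF assms(1)] by auto
  obtain l where l: "\<And>n. l \<in> C n"
  proof (rule decreasing_closed_nest[of C])
    show "closed (C n)" for n
    proof -
      have "C n = M \<inter> {m. (norm (x - m))\<^sup>2 \<le> d + 1 / real (Suc n)}"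
        by (auto simp: C_def)
      moreover have "closed {m. (norm (x - m))\<^sup>2 \<le> d + 1 / real (Suc n)}"
        by (intro closed_Collect_le continuous_intros)
      ultimately show ?thesis
        using assms(2) by (simp add: closed_Int)
    qed
    show "C n \<noteq> {}" for n
    proof -
      have "\<exists>m\<in>M. (norm (x - m))\<^sup>2 < d + 1 / real (Suc n)"
        using cINF_less_iff[OF \<open>M \<noteq> {}\<close> bdd, of "d + 1 / real (Suc n)"]
        by (simp add: d_def[symmetric])
      then show ?thesis
        by (auto simp: C_def intro: less_imp_le)
    qed
    show "C n \<subseteq> C m" if "m \<le> n" for m n
    proof -
      have "1 / real (Suc n) \<le> 1 / real (Suc m)"
        using that by (intro divide_left_mono) auto
      then show ?thesis
        by (auto simp: C_def)
    qed
    show "\<exists>n. \<forall>a\<in>C n. \<forall>b\<in>C n. dist a b < e" if "0 < e" for e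
    proof -
      obtain n where n: "1 / real (Suc n) < e\<^sup>2 / 4"
        using nat_approx_posE[of "e\<^sup>2 / 4"] \<open>0 < e\<close> by (metis zero_less_divide_iff zero_less_numeral zero_less_power)
      have "dist a b < e" if "a \<in> C n" "b \<in> C n" for a b
      proof -
        have "(1 / 2) *\<^sub>R (a + b) \<in> M"
          using that assms(1) by (auto simp: C_def intro!: subspace_mul subspace_add)
        then have "d \<le> (norm (x - (1 / 2) *\<^sub>R (a + b)))\<^sup>2"
          by (rule d_le)
        \<comment> \<open>Parallelogram law for \<open>x - a\<close> and \<open>x - b\<close>. The
          midpoint of \<open>a\<close> and \<open>b\<close> is in \<open>M\<close>, so the
          subtracted term is at least \<open>4 * d\<close>, which leaves at most
          \<open>4 / real (Suc n)\<close>.\<close>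
        moreover have "(norm (a - b))\<^sup>2 = 2 * (norm (x - a))\<^sup>2 + 2 * (norm (x - b))\<^sup>2
            - 4 * (norm (x - (1 / 2) *\<^sub>R (a + b)))\<^sup>2"
          by (simp add: power2_norm_eq_inner inner_diff_left inner_diff_right inner_add_left
              inner_add_right inner_commute algebra_simps)
        moreover have "(norm (x - a))\<^sup>2 \<le> d + 1 / real (Suc n)"
          "(norm (x - b))\<^sup>2 \<le> d + 1 / real (Suc n)"
          using that by (auto simp: C_def)
        ultimately have "(norm (a - b))\<^sup>2 < e\<^sup>2"
          using n by linarith
        then show ?thesis
          using \<open>0 < e\<close> by (simp add: dist_norm power_less_imp_less_base)
      qed
      then show ?thesis
        by blast
    qed
  qed blast
  have "l \<in> M"
    using l[of 0] by (simp add: C_def)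
  have min: "(norm (x - l))\<^sup>2 \<le> d"
  proof (rule field_le_epsilon)
    fix e :: real
    assume "0 < e"
    then obtain n where "1 / real (Suc n) < e"
      using nat_approx_posE[of e] by auto
    with l[of n] show "(norm (x - l))\<^sup>2 \<le> d + e"
      by (simp add: C_def)
  qed
  show thesis
  proof
    show "x - l \<noteq> 0"
      using \<open>l \<in> M\<close> assms(3) by auto
    show "inner (x - l) m = 0" if "m \<in> M" for m
    proof (cases "m = 0")
      case False
      \<comment> \<open>This is the minimizer of the quadratic polynomial
        \<open>norm ((x - l) - t *\<^sub>R m)\<close> squared in \<open>t\<close>. Its minimum lies
        below the value at 0 by the square of \<open>inner (x - l) m\<close> divided by
        \<open>inner m m\<close>, so that square must vanish.\<close>
      define t where "t = inner (x - l) m / inner m m"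
      have "l + t *\<^sub>R m \<in> M"
        using assms(1) \<open>l \<in> M\<close> that by (simp add: subspace_add subspace_mul)
      then have "(norm (x - l))\<^sup>2 \<le> (norm (x - (l + t *\<^sub>R m)))\<^sup>2"
        using d_le min by (meson order_trans)
      also have "x - (l + t *\<^sub>R m) = (x - l) - t *\<^sub>R m"
        by simp
      also have "(norm ((x - l) - t *\<^sub>R m))\<^sup>2
          = (norm (x - l))\<^sup>2 - 2 * t * inner (x - l) m + t * t * inner m m"
        by (simp only: power2_norm_eq_inner inner_diff_left inner_diff_right inner_scaleR_left
            inner_scaleR_right inner_commute[of m x] inner_commute[of m l]) (simp add: algebra_simps)
      also have "t * t * inner m m = t * inner (x - l) m"
        using False by (simp add: t_def)
      finally have "inner (x - l) m * inner (x - l) m / inner m m \<le> 0"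
        by (simp add: t_def)
      moreover have "inner m m > 0"
        using False by simp
      ultimately show ?thesis
        by (auto simp: divide_le_0_iff mult_le_0_iff)
    qed simp
  qed
qed

lemma subspace_closure:
  fixes D :: "'a::real_normed_vector set"
  assumes "subspace D"
  shows "subspace (closure D)"
  unfolding subspace_def
proof (intro conjI ballI allI)
  show "0 \<in> closure D"
    using subspace_0[OF assms] closure_subset by blast
  show "x + y \<in> closure D" if xy: "x \<in> closure D" "y \<in> closure D" for x y
  proof -
    obtain f g where "\<forall>n. f n \<in> D" "f \<longlonglongrightarrow> x" "\<forall>n. g n \<in> D" "g \<longlonglongrightarrow> y"
      using xy unfolding closure_sequential by blast
    then have "\<forall>n. f n + g n \<in> D" "(\<lambda>n. f n + g n) \<longlonglongrightarrow> x + y"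
      using assms by (auto intro: subspace_add tendsto_add)
    then show ?thesis
      unfolding closure_sequential by (intro exI[of _ "\<lambda>n. f n + g n"]) simp
  qed
  show "c *\<^sub>R x \<in> closure D" if x: "x \<in> closure D" for c x
  proof -
    obtain f where "\<forall>n. f n \<in> D" "f \<longlonglongrightarrow> x"
      using x unfolding closure_sequential by blast
    then have "\<forall>n. c *\<^sub>R f n \<in> D" "(\<lambda>n. c *\<^sub>R f n) \<longlonglongrightarrow> c *\<^sub>R x"
      using assms by (auto intro: subspace_mul tendsto_scaleR)
    then show ?thesis
      unfolding closure_sequential by (intro exI[of _ "\<lambda>n. c *\<^sub>R f n"]) simp
  qed
qed

section \<open>Inner products over the scalar field and adjoints\<close>

lemma conjugate_0 [simp]: "conjugate 0 = (0::'s::real_or_complex)"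
  using conjugate_add[of 0 "0::'s"] by simp

lemma conjugate_minus: "conjugate (- a) = - conjugate (a::'s::real_or_complex)"
  using conjugate_add[of a "- a"] by (simp add: eq_neg_iff_add_eq_0 add.commute)

context hilbert_space
begin

lemma ip_0_left [simp]: "ip 0 y = 0"
  using ip_add_left[of 0 0 y] by simp

lemma ip_0_right [simp]: "ip x 0 = 0"
  using ip_commute[of x 0] by simp

lemma ip_add_right: "ip x (y + z) = ip x y + ip x z"
  unfolding ip_commute[of x "y + z"] ip_commute[of x y] ip_commute[of x z]
  by (simp add: ip_add_left conjugate_add)

lemma ip_minus_right: "ip x (- y) = - ip x y"
  using ip_add_right[of x y "- y"] by (simp add: eq_neg_iff_add_eq_0 add.commute)

lemma ip_diff_right: "ip x (y - z) = ip x y - ip x z"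
  using ip_add_right[of x y "- z"] by (simp add: ip_minus_right)

text \<open>The locale ties \<open>ip\<close> to \<open>inner\<close> only on the diagonal;
  expanding both at \<open>x + y\<close> (polarization) identifies \<open>inner\<close> as the real
  part of \<open>ip\<close>.\<close>

lemma of_real_inner: "of_real (2 * inner x y) = ip x y + conjugate (ip x y)"
proof -
  have "of_real (inner x x) + of_real (inner y y) + of_real (2 * inner x y)
      = (of_real (inner (x + y) (x + y)) :: 's)"
    by (simp add: inner_add_left inner_add_right inner_commute[of y x])
  also have "\<dots> = of_real (inner x x) + of_real (inner y y) + (ip x y + ip y x)"
    by (simp only: ip_self[symmetric]) (simp add: ip_add_left ip_add_right)
  also have "ip y x = conjugate (ip x y)"
    by (rule ip_commute)
  finally show ?thesis
    by (simp only: add_left_cancel)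
qed

lemma inner_eq_0: "ip x y = 0 \<Longrightarrow> inner x y = 0"
  using of_real_inner[of x y] by simp

text \<open>A vanishing real part alone does not make \<open>ip x y\<close> zero over the complex
  numbers. The multiplier \<open>conjugate (ip x y)\<close> turns the pairing into the squared
  modulus, which is its own real part.\<close>

lemma ip_eq_0_if_inner_scale_eq_0:
  assumes "\<And>c. inner (scale c x) y = 0"
  shows "ip x y = 0"
proof -
  define c where "c = ip x y"
  have "0 = conjugate c * c + conjugate (conjugate c * c)"
    using of_real_inner[of "scale (conjugate c) x" y] assms by (simp add: ip_scale_left c_def)
  also have "\<dots> = 2 * (c * conjugate c)"
    by (simp add: conjugate_mult conjugate_conjugate mult.commute)
  also have "\<dots> = 2 * of_real ((norm c)\<^sup>2)"
    by (simp add: mult_conjugate scaleR_conv_of_real)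
  finally show ?thesis
    by (simp add: c_def)
qed

lemma subspace_imp_real_subspace: "subspace D \<Longrightarrow> Real_Vector_Spaces.subspace D"
  unfolding subspace_def Real_Vector_Spaces.subspace_def
  by (simp flip: scale_of_real)

text \<open>Projection onto the closure gives only real orthogonality; closure of \<open>D\<close>
  under all scalars upgrades it to orthogonality for \<open>ip\<close>.\<close>

lemma dense_subspaceI:
  assumes "subspace D" and "\<And>u. (\<And>x. x \<in> D \<Longrightarrow> ip x u = 0) \<Longrightarrow> u = 0"
  shows "closure D = UNIV"
proof (rule ccontr)
  assume "closure D \<noteq> UNIV"
  then obtain x where "x \<notin> closure D"
    by auto
  obtain u where "u \<noteq> 0" and u: "\<And>m. m \<in> closure D \<Longrightarrow> inner u m = 0"
    by (rule exists_orthogonal_to_proper_closed_subspace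
        [OF subspace_closure[OF subspace_imp_real_subspace[OF assms(1)]] closed_closure
          \<open>x \<notin> closure D\<close>]) blast
  have "ip x u = 0" if "x \<in> D" for x
  proof (rule ip_eq_0_if_inner_scale_eq_0)
    show "inner (scale c x) u = 0" for c
      using u[of "scale c x"] subspace_scale[OF assms(1) that, of c] closure_subset[of D]
      by (auto simp: inner_commute)
  qed
  with assms(2) \<open>u \<noteq> 0\<close> show False
    by blast
qed

text \<open>Orthogonality to the fixed vector \<open>y - z\<close> is a closed condition, so it
  passes from \<open>D\<close> to the whole space, and \<open>y - z\<close> is orthogonal to
  itself.\<close>

lemma eq_if_ip_eq_on_dense:
  assumes "closure D = UNIV" and "\<And>x. x \<in> D \<Longrightarrow> ip x y = ip x z"
  shows "y = z"
proof -
  have "D \<subseteq> {x. inner x (y - z) = 0}"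
    using assms(2) by (auto simp: ip_diff_right intro: inner_eq_0)
  moreover have "closed {x. inner x (y - z) = 0}"
    by (intro closed_Collect_eq continuous_intros)
  ultimately have "closure D \<subseteq> {x. inner x (y - z) = 0}"
    by (rule closure_minimal)
  then have "y - z \<in> {x. inner x (y - z) = 0}"
    using assms(1) by blast
  then show ?thesis
    by simp
qed

text \<open>Density makes the vector in the definition unique, which eliminates the
  \<open>THE\<close>; later proofs handle adjoints through this equivalence.\<close>

lemma adjoint_op_eq_Some_iff:
  assumes "densely_defined S"
  shows "adjoint_op ip ip' S y = Some z \<longleftrightarrow> (\<forall>x\<in>dom S. ip' (the (S x)) y = ip x z)"
proof -
  let ?P = "\<lambda>z. \<forall>x\<in>dom S. ip' (the (S x)) y = ip x z"
  have "z = z'" if "?P z" "?P z'" for z z'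
  proof (rule eq_if_ip_eq_on_dense)
    show "closure (dom S) = UNIV"
      using assms by (simp add: densely_defined_def)
    show "ip x z = ip x z'" if "x \<in> dom S" for x
      using \<open>?P z\<close> \<open>?P z'\<close> that by (metis (no_types))
  qed
  then have the_eq: "(THE z. ?P z) = z" if "?P z" for z
    using that by (intro the_equality)
  show ?thesis
  proof
    assume eq: "adjoint_op ip ip' S y = Some z"
    then obtain z' where "?P z'"
      by (auto simp only: adjoint_op_def split: if_splits)
    with eq the_eq[of z'] show "?P z"
      by (simp only: adjoint_op_def if_P[OF exI[of ?P z']] option.inject)
  next
    assume "?P z"
    with the_eq[of z] show "adjoint_op ip ip' S y = Some z"
      by (simp only: adjoint_op_def if_P[OF exI[of ?P z]])
  qed
qed

end

section \<open>Sums of operators, graphs and block operators\<close>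

lemma op_add_eq_Some_iff:
  "op_add A B x = Some z \<longleftrightarrow> (\<exists>a b. A x = Some a \<and> B x = Some b \<and> z = a + b)"
  by (auto simp: op_add_def)

lemma dom_op_add: "dom (op_add A B) = dom A \<inter> dom B"
  by (auto simp: op_add_def split: if_splits)

lemma linear_operator_op_add:
  assumes "vector_space scaleH" "vector_space scaleK"
    and "linear_operator scaleH scaleK A" "linear_operator scaleH scaleK B"
  shows "linear_operator scaleH scaleK (op_add A B)"
proof -
  interpret H: vector_space scaleH by fact
  interpret K: vector_space scaleK by fact
  show ?thesis
    using assms(3,4) unfolding linear_operator_def dom_op_add
    by (auto simp: H.subspace_inter op_add_def K.scale_right_distrib H.subspace_add
        H.subspace_scale dom_def[symmetric])
qed

lemma linear_operator_0:
  assumes "vector_space scaleH" "linear_operator scaleH scaleK S"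
  shows "S 0 = Some 0"
proof -
  interpret H: vector_space scaleH by fact
  have "0 \<in> dom S" "the (S (0 + 0)) = the (S 0) + the (S 0)"
    using assms(2) H.subspace_0 unfolding linear_operator_def by blast+
  then show ?thesis
    by auto
qed

text \<open>For densely defined \<open>S\<close>, the right-hand side says that the adjoint of
  \<open>S\<close> maps \<open>v\<close> to \<open>- u\<close>.\<close>

lemma mem_ortho_compl_graph_iff:
  "(u, v) \<in> ortho_compl (prod_ip ipH ipK) (Map.graph S)
    \<longleftrightarrow> (\<forall>x\<in>dom S. ipH x u + ipK (the (S x)) v = 0)"
  by (auto simp: ortho_compl_def Map.graph_def prod_ip_def dom_def)

lemma mem_ran_block_op_iff:
  "(u, v) \<in> ran (block_op S T)
    \<longleftrightarrow> (\<exists>x\<in>dom S. \<exists>y\<in>dom T. u = x - the (T y) \<and> v = the (S x) + y)"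
  by (simp add: ran_def block_op_def) blast

text \<open>The sums enter the equivalence only through the pairing identity \<open>pair\<close>,
  linearity of \<open>S\<close> and the value of \<open>T\<close> at 0, so it is proved for any such
  pair of operators.\<close>

theorem adjoint_eq_iff_graph_compl_subset_ran_block_op:
  fixes scaleH :: "'s::real_or_complex \<Rightarrow> 'h::{real_inner,complete_space} \<Rightarrow> 'h"
    and scaleK :: "'s \<Rightarrow> 'k::{real_inner,complete_space} \<Rightarrow> 'k"
  assumes "hilbert_space scaleH ipH" "hilbert_space scaleK ipK"
    and S: "linear_operator scaleH scaleK S" and T0: "T 0 = Some 0"
    and pair: "\<And>x y. x \<in> dom S \<Longrightarrow> y \<in> dom T \<Longrightarrow> ipK (the (S x)) y = ipH x (the (T y))"
  shows "densely_defined S \<and> adjoint_op ipH ipK S = T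
    \<longleftrightarrow> ortho_compl (prod_ip ipH ipK) (Map.graph S) \<subseteq> ran (block_op S T)"
proof -
  interpret H: hilbert_space scaleH ipH by fact
  interpret K: hilbert_space scaleK ipK by fact
  have S0: "S 0 = Some 0"
    by (rule linear_operator_0[OF H.vector_space_axioms S])
  show ?thesis
  proof (intro iffI subsetI; (elim conjE)?)
    fix p
    assume dd: "densely_defined S" and adj: "adjoint_op ipH ipK S = T"
      and p: "p \<in> ortho_compl (prod_ip ipH ipK) (Map.graph S)"
    obtain u v where uv: "p = (u, v)"
      by (cases p)
    have "\<forall>x\<in>dom S. ipK (the (S x)) v = ipH x (- u)"
      using p by (simp add: uv mem_ortho_compl_graph_iff H.ip_minus_right eq_neg_iff_add_eq_0
          add.commute)
    then have "T v = Some (- u)"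
      using H.adjoint_op_eq_Some_iff[OF dd, of ipK v "- u"] adj by simp
    then show "p \<in> ran (block_op S T)"
      unfolding uv mem_ran_block_op_iff using S0 by (intro bexI[of _ 0] bexI[of _ v]) auto
  next
    assume sub: "ortho_compl (prod_ip ipH ipK) (Map.graph S) \<subseteq> ran (block_op S T)"
    have T_eq: "T v = Some (- u)" if orth: "\<forall>x\<in>dom S. ipH x u + ipK (the (S x)) v = 0" for u v
    proof -
      have "(u, v) \<in> ran (block_op S T)"
        using sub orth mem_ortho_compl_graph_iff[of u v ipH ipK S] by blast
      then obtain x y where x: "x \<in> dom S" and y: "y \<in> dom T"
        and u: "u = x - the (T y)" and v: "v = the (S x) + y"
        unfolding mem_ran_block_op_iff by blast
      have "0 = ipH x u + ipK (the (S x)) v"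
        using orth x by simp
      \<comment> \<open>The cross terms, minus \<open>ipH x (the (T y))\<close> and plus
        \<open>ipK (the (S x)) y\<close>, cancel by \<open>pair\<close>.\<close>
      also have "\<dots> = of_real (inner x x + inner (the (S x)) (the (S x)))"
        using pair[OF x y] by (simp add: u v H.ip_diff_right K.ip_add_right H.ip_self K.ip_self)
      finally have "inner x x + inner (the (S x)) (the (S x)) = 0"
        by (metis of_real_eq_0_iff)
      then have "x = 0"
        using inner_ge_zero[of x] inner_ge_zero[of "the (S x)"]
        by (metis add_nonneg_eq_0_iff inner_eq_zero_iff)
      with S0 y show ?thesis
        by (auto simp: u v)
    qed
    have dd: "densely_defined S"
      unfolding densely_defined_def
    proof (rule H.dense_subspaceI)
      show "H.subspace (dom S)"
        using S by (simp add: linear_operator_def)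
      show "u = 0" if "\<And>x. x \<in> dom S \<Longrightarrow> ipH x u = 0" for u
        \<comment> \<open>With \<open>v = 0\<close> the value of \<open>T\<close> at 0 is both
          \<open>- u\<close> and 0.\<close>
        using T_eq[of u 0] that T0 by simp
    qed
    moreover have "adjoint_op ipH ipK S = T"
    proof (rule ext, rule option.expand)
      \<comment> \<open>Left to right is the inclusion of the adjoint in \<open>T\<close>, from
        \<open>T_eq\<close>; right to left is the formal adjointness \<open>pair\<close>.\<close>
      have *: "adjoint_op ipH ipK S y = Some z \<longleftrightarrow> T y = Some z" for y z
      proof
        assume "adjoint_op ipH ipK S y = Some z"
        then show "T y = Some z"
          using T_eq[of "- z" y] by (simp add: H.adjoint_op_eq_Some_iff[OF dd] H.ip_minus_right)
      next
        assume "T y = Some z"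
        then show "adjoint_op ipH ipK S y = Some z"
          using pair[of _ y] by (simp add: H.adjoint_op_eq_Some_iff[OF dd] domI)
      qed
      show "(adjoint_op ipH ipK S y = None) = (T y = None)" for y
        using * by (metis not_None_eq)
      show "the (adjoint_op ipH ipK S y) = the (T y)"
        if "adjoint_op ipH ipK S y \<noteq> None" for y
        using that * by (metis option.collapse)
    qed
    ultimately show "densely_defined S \<and> adjoint_op ipH ipK S = T" ..
  qed
qed

theorem theorem2p1:
  fixes scaleH :: "'s::real_or_complex \<Rightarrow> 'h::{real_inner,complete_space} \<Rightarrow> 'h"
    and scaleK :: "'s \<Rightarrow> 'k::{real_inner,complete_space} \<Rightarrow> 'k"
    and ipH :: "'h \<Rightarrow> 'h \<Rightarrow> 's"
    and ipK :: "'k \<Rightarrow> 'k \<Rightarrow> 's"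
    and A B :: "'h \<rightharpoonup> 'k"
  assumes "hilbert_space scaleH ipH"
    and "hilbert_space scaleK ipK"
    and "linear_operator scaleH scaleK A" and "densely_defined A"
    and "linear_operator scaleH scaleK B" and "densely_defined B"
  shows "(densely_defined (op_add A B) \<and>
      adjoint_op ipH ipK (op_add A B) = op_add (adjoint_op ipH ipK A) (adjoint_op ipH ipK B))
    \<longleftrightarrow>
      ortho_compl (prod_ip ipH ipK) (Map.graph (op_add A B))
        \<subseteq> ran (block_op (op_add A B) (op_add (adjoint_op ipH ipK A) (adjoint_op ipH ipK B)))"
proof -
  interpret H: hilbert_space scaleH ipH by fact
  interpret K: hilbert_space scaleK ipK by fact
  show ?thesis
  proof (rule adjoint_eq_iff_graph_compl_subset_ran_block_op[OF assms(1,2)])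
    show "linear_operator scaleH scaleK (op_add A B)"
      using assms by (intro linear_operator_op_add H.vector_space_axioms K.vector_space_axioms)
    \<comment> \<open>Density of \<open>A\<close> and of \<open>B\<close> separately is what applies
      here, since their sum is not known to be densely defined.\<close>
    have "adjoint_op ipH ipK A 0 = Some 0" "adjoint_op ipH ipK B 0 = Some 0"
      using assms(4,6) by (simp_all add: H.adjoint_op_eq_Some_iff)
    then show "op_add (adjoint_op ipH ipK A) (adjoint_op ipH ipK B) 0 = Some 0"
      by (simp add: op_add_eq_Some_iff)
    show "ipK (the (op_add A B x)) y
        = ipH x (the (op_add (adjoint_op ipH ipK A) (adjoint_op ipH ipK B) y))"
      if x: "x \<in> dom (op_add A B)"
        and y: "y \<in> dom (op_add (adjoint_op ipH ipK A) (adjoint_op ipH ipK B))" for x y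
    proof -
      obtain a b where A: "A x = Some a" and B: "B x = Some b"
        using x by (auto simp: dom_op_add)
      obtain a' b' where A': "adjoint_op ipH ipK A y = Some a'"
        and B': "adjoint_op ipH ipK B y = Some b'"
        using y by (auto simp: dom_op_add)
      have "ipK a y = ipH x a'" "ipK b y = ipH x b'"
        using A A' B B' assms(4,6) by (force simp: H.adjoint_op_eq_Some_iff)+
      then show ?thesis
        using A A' B B' by (simp add: op_add_def domI K.ip_add_left H.ip_add_right)
    qed
  qed
qed

end
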